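(* Let $X$ be a finite set with $|X|=n$, and let $a\in\mathcal T_X$ be an idempotent with $r=\operatorname{rank}(a)$, where $1<r<n$. Let $P=\operatorname{Reg}(\mathcal T_X^a)$, let $D=D_r^a=\{f\in P:\operatorname{rank}(f)=r\}$ be the top $\mathscr D^a$-class of $P$, and let $E=E_a(\mathcal T_X)=E_a(P)$ be the set of idempotents of $\mathcal T_X^a$. Then $$\mathcal E_X^a=\langle E\rangle_a=E_a(D)\cup(P\setminus D).$$
   Context: $\mathcal T_X$ is the full transformation semigroup of all maps $X\to X$ under composition; maps are written on the right and composed from left to right; $\operatorname{rank}(f)=|\operatorname{im}(f)|$. The variant $\mathcal T_X^a$ is the semigroup with underlying set $\mathcal T_X$ and operation $f\star g=fag$. $\operatorname{Reg}(\mathcal T_X^a)=\{f\in\mathcal T_X:\operatorname{rank}(afa)=\operatorname{rank}(f)\}$ is its set of regular elements, a subsemigroup of $\mathcal T_X^a$ whose $\mathscr D$-classes $D_m^a=\{f\in P:\operatorname{rank}(f)=m\}$ ($1\le m\le r$) form a chain $D_1^a<\dots<D_r^a$. For $U\subseteq\mathcal T_X$, $E_a(U)=\{f\in U:f=f\star f\}$ and $\langle U\rangle_a$ is the subsemigroup of $\mathcal T_X^a$ generated by $U$. $\mathcal E_X^a$ denotes the subsemigroup of $\mathcal T_X^a$ generated by all its idempotents. *)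

theory Defs
  imports "HOL-Library.FuncSet"
begin

text \<open>
  A semigroup is given by a carrier set and a binary operation; the variants below have no
  identity element in general, so the monoid records of HOL-Algebra do not fit.
\<close>

definition regular_elements :: "'s set \<Rightarrow> ('s \<Rightarrow> 's \<Rightarrow> 's) \<Rightarrow> 's set" where
  "regular_elements S m = {x \<in> S. \<exists>y\<in>S. x = m (m x y) x}"

definition idempotents_in :: "('s \<Rightarrow> 's \<Rightarrow> 's) \<Rightarrow> 's set \<Rightarrow> 's set" where
  "idempotents_in m U = {x \<in> U. x = m x x}"

inductive_set generated_subsemigroup :: "('s \<Rightarrow> 's \<Rightarrow> 's) \<Rightarrow> 's set \<Rightarrow> 's set"
  for m :: "'s \<Rightarrow> 's \<Rightarrow> 's" and U :: "'s set" where
  incl: "x \<in> U \<Longrightarrow> x \<in> generated_subsemigroup m U"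
| mult: "x \<in> generated_subsemigroup m U \<Longrightarrow> y \<in> generated_subsemigroup m U \<Longrightarrow>
    m x y \<in> generated_subsemigroup m U"

text \<open>
  Maps \<open>X \<rightarrow> X\<close> are extensional functions, so that two transformations are equal iff they agree
  on \<open>X\<close>. They act on the right: \<open>tcomp X f g\<close> is \<open>f\<close> followed by \<open>g\<close>.
\<close>

definition transformations :: "'a set \<Rightarrow> ('a \<Rightarrow> 'a) set" where
  "transformations X = (X \<rightarrow>\<^sub>E X)"

definition tcomp :: "'a set \<Rightarrow> ('a \<Rightarrow> 'a) \<Rightarrow> ('a \<Rightarrow> 'a) \<Rightarrow> 'a \<Rightarrow> 'a" where
  "tcomp X f g = compose X g f"

definition rank :: "'a set \<Rightarrow> ('a \<Rightarrow> 'a) \<Rightarrow> nat" where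
  "rank X f = card (f ` X)"

definition vmult :: "'a set \<Rightarrow> ('a \<Rightarrow> 'a) \<Rightarrow> ('a \<Rightarrow> 'a) \<Rightarrow> ('a \<Rightarrow> 'a) \<Rightarrow> 'a \<Rightarrow> 'a" where
  "vmult X a f g = tcomp X (tcomp X f a) g"

definition Reg_variant :: "'a set \<Rightarrow> ('a \<Rightarrow> 'a) \<Rightarrow> ('a \<Rightarrow> 'a) set" where
  "Reg_variant X a = regular_elements (transformations X) (vmult X a)"

definition idem_generated_variant :: "'a set \<Rightarrow> ('a \<Rightarrow> 'a) \<Rightarrow> ('a \<Rightarrow> 'a) set" where
  "idem_generated_variant X a =
     generated_subsemigroup (vmult X a) (idempotents_in (vmult X a) (transformations X))"

lemma tcomp_apply: "x \<in> X \<Longrightarrow> tcomp X f g x = g (f x)"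
  by (simp add: tcomp_def compose_def)

lemma tcomp_closed:
  "f \<in> transformations X \<Longrightarrow> g \<in> transformations X \<Longrightarrow> tcomp X f g \<in> transformations X"
  by (auto simp: transformations_def tcomp_def compose_def PiE_iff)

lemma transformations_mem: "f \<in> transformations X \<Longrightarrow> x \<in> X \<Longrightarrow> f x \<in> X"
  by (auto simp: transformations_def)

lemma transformations_eqI:
  assumes "f \<in> transformations X" "g \<in> transformations X" "\<And>x. x \<in> X \<Longrightarrow> f x = g x"
  shows "f = g"
  using assms unfolding transformations_def by (rule PiE_ext)

lemma vmult_apply: "x \<in> X \<Longrightarrow> vmult X a f g x = g (a (f x))"
  by (simp add: vmult_def tcomp_apply)

lemma vmult_closed:
  "a \<in> transformations X \<Longrightarrow> f \<in> transformations X \<Longrightarrow> g \<in> transformations X \<Longrightarrow>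
   vmult X a f g \<in> transformations X"
  by (simp add: vmult_def tcomp_closed)

lemma vmult_assoc:
  assumes "a \<in> transformations X" "f \<in> transformations X" "g \<in> transformations X"
    "h \<in> transformations X"
  shows "vmult X a (vmult X a f g) h = vmult X a f (vmult X a g h)"
  using assms
  by (intro transformations_eqI[of _ X]) (auto simp: vmult_closed vmult_apply transformations_mem)

lemma Reg_variant_eq_rank:
  assumes X: "finite X" and a: "a \<in> transformations X"
  shows "Reg_variant X a =
    {f \<in> transformations X. rank X (tcomp X (tcomp X a f) a) = rank X f}"
proof (intro subset_antisym subsetI)
  fix f assume "f \<in> Reg_variant X a"
  then obtain g where f: "f \<in> transformations X" and g: "g \<in> transformations X"
    and fg: "f = vmult X a (vmult X a f g) f"
    by (auto simp: Reg_variant_def regular_elements_def)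
  have fgx: "f x = f (a (g (a (f x))))" if "x \<in> X" for x
    using fg that by (metis vmult_apply)
  define h where "h = tcomp X (tcomp X a f) a"
  have hx: "h x = a (f (a x))" if "x \<in> X" for x
    using that by (simp add: h_def tcomp_apply)
  have "f ` X \<subseteq> (\<lambda>y. f (a (g y))) ` (h ` X)"
  proof
    fix y assume "y \<in> f ` X"
    then obtain x where x: "x \<in> X" "y = f x" by blast
    define z where "z = g (a (f x))"
    have z: "z \<in> X" using x a f g by (simp add: z_def transformations_mem)
    have "y = f (a z)" using fgx x by (simp add: z_def)
    moreover have "f (a z) = f (a (g (a (f (a z)))))"
      using fgx[of "a z"] z a by (simp add: transformations_mem)
    ultimately show "y \<in> (\<lambda>y. f (a (g y))) ` (h ` X)"
      using z hx by auto
  qed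
  then have 1: "card (f ` X) \<le> card (h ` X)"
    using X by (meson finite_imageI surj_card_le)
  have "h ` X \<subseteq> a ` (f ` X)" using hx a by (auto simp: transformations_mem)
  then have "card (h ` X) \<le> card (f ` X)"
    using X by (meson finite_imageI surj_card_le)
  with 1 f show "f \<in> {f \<in> transformations X. rank X (tcomp X (tcomp X a f) a) = rank X f}"
    by (simp add: rank_def h_def)
next
  fix f assume "f \<in> {f \<in> transformations X. rank X (tcomp X (tcomp X a f) a) = rank X f}"
  then have f: "f \<in> transformations X"
    and "card (tcomp X (tcomp X a f) a ` X) = card (f ` X)" by (auto simp: rank_def)
  moreover have "tcomp X (tcomp X a f) a ` X = a ` f ` a ` X"
    by (simp add: image_image tcomp_apply)
  ultimately have card: "card (a ` f ` a ` X) = card (f ` X)" by simp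
  have sub: "f ` a ` X \<subseteq> f ` X" using a by (auto simp: transformations_mem)
  have "card (a ` f ` a ` X) \<le> card (f ` a ` X)" using X by (simp add: card_image_le)
  then have im: "f ` a ` X = f ` X"
    using card sub X by (metis card_seteq finite_imageI)
  then have inj: "inj_on a (f ` X)" using card X by (metis eq_card_imp_inj_on finite_imageI)
  define p where "p y = (SOME x. x \<in> X \<and> f (a x) = y)" for y
  have p: "p y \<in> X \<and> f (a (p y)) = y" if "y \<in> f ` X" for y
  proof -
    have "\<exists>x. x \<in> X \<and> f (a x) = y" using that im by (metis (no_types, lifting) imageE)
    then show ?thesis unfolding p_def by (rule someI_ex)
  qed
  define g where
    "g = (\<lambda>w\<in>X. if w \<in> a ` f ` X then p (inv_into (f ` X) a w) else w)"
  have g: "g \<in> transformations X"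
    using p by (auto simp: g_def transformations_def inv_into_into inj)
  have "f = vmult X a (vmult X a f g) f"
  proof (rule transformations_eqI[of _ X])
    fix x assume x: "x \<in> X"
    then have "g (a (f x)) = p (f x)"
      using a f inj by (simp add: g_def transformations_mem)
    then show "f x = vmult X a (vmult X a f g) f x" using x p by (simp add: vmult_apply)
  qed (use a f g in \<open>simp_all add: vmult_closed\<close>)
  then show "f \<in> Reg_variant X a"
    using f g by (auto simp: Reg_variant_def regular_elements_def)
qed

lemma idempotents_in_Reg_variant:
  "idempotents_in (vmult X a) (transformations X) = idempotents_in (vmult X a) (Reg_variant X a)"
  unfolding idempotents_in_def Reg_variant_def regular_elements_def
  by (rule Collect_cong) (auto, metis)

end

theory Submission
  imports Defs "HOL-Combinatorics.Permutations"
begin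

text \<open>
  Let \<open>A = im a\<close>. A transformation \<open>f\<close> is regular in the variant iff \<open>f\<close> maps \<open>A\<close> onto \<open>im f\<close>
  and \<open>a\<close> is injective on \<open>im f\<close> (\<open>Reg_variant_iff\<close>). In particular regular elements have rank
  at most \<open>r = |A|\<close> and form a subsemigroup.

  For the inclusion from left to right, an idempotent of rank \<open>r\<close> satisfies \<open>a (f z) = z\<close> for all
  \<open>z \<in> A\<close>. This property passes to products, and together with regularity it implies idempotency.
  As a product of rank \<open>r\<close> has factors of rank \<open>r\<close>, a product of idempotents that has rank \<open>r\<close>
  is itself idempotent.

  For the converse, the elements \<open>t \<circ> a\<close> with \<open>t\<close> a transformation of \<open>A\<close> form a copy of
  the full transformation semigroup of \<open>A\<close> inside the variant. By Howie's theorem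
  (\<open>singular_idempotent_generated\<close>), the non-invertible ones among them are products of idempotents.
  A regular \<open>f\<close> of rank less than \<open>r\<close> factorises as \<open>e \<star> (a \<circ> f \<circ> a) \<star> h\<close> with \<open>e\<close> and \<open>h\<close>
  idempotent (\<open>Reg_variant_factorisation\<close>): \<open>e\<close> chooses for every point of \<open>X\<close> a point of \<open>A\<close> with
  the same value under \<open>f\<close>, and \<open>h\<close> recovers a point of \<open>im f\<close> from its image under \<open>a\<close>.
  The middle factor is the copy of a non-invertible transformation of \<open>A\<close>.
\<close>

section \<open>Howie's theorem on singular transformations\<close>

lemma generated_subsemigroup_subset:
  assumes "U \<subseteq> S" and "\<And>x y. x \<in> S \<Longrightarrow> y \<in> S \<Longrightarrow> m x y \<in> S"
  shows "generated_subsemigroup m U \<subseteq> S"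
proof
  fix x assume "x \<in> generated_subsemigroup m U"
  then show "x \<in> S" by induction (use assms in auto)
qed

text \<open>For \<open>i, j \<in> A\<close>, the idempotent that moves \<open>i\<close> to \<open>j\<close> and fixes every other point.\<close>

definition collapse :: "'a set \<Rightarrow> 'a \<Rightarrow> 'a \<Rightarrow> 'a \<Rightarrow> 'a" where
  "collapse A i j = (\<lambda>x\<in>A. if x = i then j else x)"

lemma collapse_idempotent:
  assumes "i \<in> A" "j \<in> A"
  shows "collapse A i j \<in> idempotents_in (tcomp A) (transformations A)"
proof -
  have c: "collapse A i j \<in> transformations A"
    using assms by (auto simp: collapse_def transformations_def)
  have "collapse A i j = tcomp A (collapse A i j) (collapse A i j)"
    by (rule transformations_eqI[OF c tcomp_closed[OF c c]])
      (use assms in \<open>auto simp: tcomp_apply collapse_def\<close>)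
  with c show ?thesis by (simp add: idempotents_in_def)
qed

text \<open>
  A transposition can be absorbed by a non-surjective map: a point \<open>i\<close> outside the image serves as
  intermediate storage, so that the swap is carried out by three collapses. If \<open>i\<close> is one of the
  two points to be swapped, a single collapse suffices.
\<close>

lemma transpose_absorbed:
  assumes A: "k \<in> A" "l \<in> A" "k \<noteq> l" and i: "i \<in> A" "i \<notin> s ` A"
    and s: "s \<in> generated_subsemigroup (tcomp A) (idempotents_in (tcomp A) (transformations A))"
      (is "_ \<in> ?S")
  shows "(\<lambda>x\<in>A. transpose k l (s x)) \<in> ?S"
proof -
  have sT: "s \<in> transformations A"
    using generated_subsemigroup_subset[of "idempotents_in (tcomp A) (transformations A)"
        "transformations A" "tcomp A"] s
    by (auto simp: idempotents_in_def tcomp_closed)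
  have c: "collapse A u v \<in> ?S" if "u \<in> A" "v \<in> A" for u v
    using that by (intro generated_subsemigroup.incl collapse_idempotent)
  have sA: "s x \<in> A" "s x \<noteq> i" if "x \<in> A" for x
    using sT i that by (auto simp: transformations_mem)
  have swap_eq: "(\<lambda>x\<in>A. transpose k l (s x)) = tcomp A g h"
    if "\<And>x. x \<in> A \<Longrightarrow> s x \<in> A \<Longrightarrow> s x \<noteq> i \<Longrightarrow> tcomp A g h x = transpose k l (s x)" for g h
  proof
    show "(\<lambda>x\<in>A. transpose k l (s x)) x = tcomp A g h x" for x
    proof (cases "x \<in> A")
      case True
      then show ?thesis using that[of x] sA[of x] by simp
    qed (simp add: tcomp_def compose_def)
  qed
  consider "i = k" | "i = l" | "i \<noteq> k" "i \<noteq> l" by blast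
  then show ?thesis
  proof cases
    case 1
    have "(\<lambda>x\<in>A. transpose k l (s x)) = tcomp A s (collapse A l k)"
      by (rule swap_eq) (use 1 A in \<open>auto simp: tcomp_apply collapse_def transpose_def\<close>)
    then show ?thesis using generated_subsemigroup.mult[OF s c] A by simp
  next
    case 2
    have "(\<lambda>x\<in>A. transpose k l (s x)) = tcomp A s (collapse A k l)"
      by (rule swap_eq) (use 2 A in \<open>auto simp: tcomp_apply collapse_def transpose_def\<close>)
    then show ?thesis using generated_subsemigroup.mult[OF s c] A by simp
  next
    case 3
    have "(\<lambda>x\<in>A. transpose k l (s x)) =
        tcomp A (tcomp A (tcomp A s (collapse A k i)) (collapse A l k)) (collapse A i l)"
      by (rule swap_eq) (use 3 A i(1) in \<open>auto simp: tcomp_apply collapse_def transpose_def\<close>)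
    then show ?thesis using A i by (simp add: generated_subsemigroup.mult s c)
  qed
qed

text \<open>
  Choosing one point from each fibre of \<open>f\<close> gives an idempotent \<open>e\<close> with the same kernel as \<open>f\<close>. The
  bijection from \<open>im e\<close> onto \<open>im f\<close> that \<open>f\<close> induces extends to a permutation, since the complements
  of the two images are equinumerous.
\<close>

lemma factorisation_idempotent_permutation:
  assumes A: "finite A" and f: "f \<in> transformations A"
  obtains e p where "e \<in> idempotents_in (tcomp A) (transformations A)" "p permutes A"
    "card (e ` A) = rank A f" "f = (\<lambda>x\<in>A. p (e x))"
proof -
  define e where "e = (\<lambda>x\<in>A. inv_into A f (f x))"
  have eA: "e x \<in> A" and fe: "f (e x) = f x" if "x \<in> A" for x
    using that by (auto simp: e_def inv_into_into f_inv_into_f)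
  have eT: "e \<in> transformations A" using eA by (auto simp: transformations_def e_def)
  have ee: "e (e x) = e x" if "x \<in> A" for x
    using eA fe that by (simp add: e_def)
  have idem: "e \<in> idempotents_in (tcomp A) (transformations A)"
    using eT ee by (auto simp: idempotents_in_def tcomp_closed tcomp_apply
        intro!: transformations_eqI[of e A])
  have "inj_on f (e ` A)"
    by (rule inj_onI) (use fe in \<open>auto simp: e_def\<close>)
  moreover have "f ` e ` A = f ` A" using fe by (auto simp: image_image)
  ultimately have b1: "bij_betw f (e ` A) (f ` A)" by (simp add: bij_betw_def)
  have eAA: "e ` A \<subseteq> A" and fAA: "f ` A \<subseteq> A" using eA f by (auto simp: transformations_mem)
  have card_eq: "card (e ` A) = card (f ` A)" using b1 by (rule bij_betw_same_card)
  then have "card (A - e ` A) = card (A - f ` A)"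
    using A eAA fAA by (simp add: card_Diff_subset)
  then obtain g where b2: "bij_betw g (A - e ` A) (A - f ` A)"
    using A by (metis finite_Diff finite_same_card_bij)
  define p where "p x = (if x \<in> e ` A then f x else if x \<in> A then g x else x)" for x
  have "bij_betw p (e ` A) (f ` A)"
    using b1 by (rule bij_betw_cong[THEN iffD1, rotated]) (simp add: p_def)
  moreover have "bij_betw p (A - e ` A) (A - f ` A)"
    using b2 by (rule bij_betw_cong[THEN iffD1, rotated]) (auto simp: p_def)
  ultimately have "bij_betw p (e ` A \<union> (A - e ` A)) (f ` A \<union> (A - f ` A))"
    by (rule bij_betw_combine) auto
  then have "bij_betw p A A" using eAA fAA by (simp add: Un_absorb1)
  then have "p permutes A" using eAA by (rule_tac bij_imp_permutes) (auto simp: p_def)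
  moreover have "f = (\<lambda>x\<in>A. p (e x))"
  proof
    show "f x = (\<lambda>x\<in>A. p (e x)) x" for x
      using f fe by (cases "x \<in> A") (auto simp: p_def transformations_def)
  qed
  ultimately show ?thesis using that idem card_eq by (simp add: rank_def)
qed

text \<open>
  Howie's theorem: every transformation of a finite set that is not a permutation is a product of
  idempotents. Such a map is a non-surjective idempotent followed by a permutation, and the
  permutation is absorbed one transposition at a time.
\<close>

theorem singular_idempotent_generated:
  assumes A: "finite A" and f: "f \<in> transformations A" and rank: "rank A f < card A"
  shows "f \<in> generated_subsemigroup (tcomp A) (idempotents_in (tcomp A) (transformations A))"
    (is "_ \<in> ?S")
proof -
  obtain e p where e: "e \<in> idempotents_in (tcomp A) (transformations A)" and p: "p permutes A"
    and card_e: "card (e ` A) = rank A f" and fpe: "f = (\<lambda>x\<in>A. p (e x))"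
    using factorisation_idempotent_permutation[OF A f] .
  have eT: "e \<in> transformations A" using e by (simp add: idempotents_in_def)
  from p A have "(\<lambda>x\<in>A. p (e x)) \<in> ?S"
  proof (induction rule: permutes_induct)
    case id
    have "(\<lambda>x\<in>A. id (e x)) = e"
      using eT by (auto simp: transformations_def PiE_def extensional_restrict)
    then show ?case using e by (simp add: generated_subsemigroup.incl)
  next
    case (swap k l p)
    let ?s = "\<lambda>x\<in>A. p (e x)"
    have "card (?s ` A) \<le> card (e ` A)"
      using card_image_le[of "e ` A" p] A by (simp add: image_image)
    then have "?s ` A \<noteq> A" using card_e rank by auto
    moreover have "?s ` A \<subseteq> A"
      using eT swap.hyps by (auto simp: transformations_mem permutes_in_image)
    ultimately obtain i where "i \<in> A" "i \<notin> ?s ` A" by blast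
    from transpose_absorbed[OF _ _ _ this swap.IH] swap.hyps
    have "(\<lambda>x\<in>A. transpose k l (?s x)) \<in> ?S" by simp
    also have "(\<lambda>x\<in>A. transpose k l (?s x)) = (\<lambda>x\<in>A. (transpose k l \<circ> p) (e x))"
      by auto
    finally show ?case .
  qed
  with fpe show ?thesis by simp
qed

section \<open>Regular elements and idempotents of the variant\<close>

lemma Reg_variant_iff:
  assumes X: "finite X" and a: "a \<in> transformations X"
  shows "f \<in> Reg_variant X a \<longleftrightarrow>
    f \<in> transformations X \<and> f ` a ` X = f ` X \<and> inj_on a (f ` X)"
proof (cases "f \<in> transformations X")
  case True
  have im: "tcomp X (tcomp X a f) a ` X = a ` f ` a ` X"
    by (simp add: image_image tcomp_apply)
  have sub: "f ` a ` X \<subseteq> f ` X" using a by (auto simp: transformations_mem)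
  have "card (a ` f ` a ` X) = card (f ` X) \<longleftrightarrow> f ` a ` X = f ` X \<and> inj_on a (f ` X)"
  proof
    assume card: "card (a ` f ` a ` X) = card (f ` X)"
    moreover have "card (a ` f ` a ` X) \<le> card (f ` a ` X)" using X by (simp add: card_image_le)
    ultimately have "f ` a ` X = f ` X" using sub X by (metis card_seteq finite_imageI)
    then show "f ` a ` X = f ` X \<and> inj_on a (f ` X)"
      using card X by (metis eq_card_imp_inj_on finite_imageI)
  qed (simp add: card_image)
  then show ?thesis using True im by (simp add: Reg_variant_eq_rank[OF X a] rank_def)
qed (simp add: Reg_variant_eq_rank[OF X a])

lemma Reg_variant_vmult_closed:
  assumes X: "finite X" and a: "a \<in> transformations X"
    and f: "f \<in> Reg_variant X a" and g: "g \<in> Reg_variant X a"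
  shows "vmult X a f g \<in> Reg_variant X a"
proof -
  note iff = Reg_variant_iff[OF X a]
  have f': "f \<in> transformations X" "f ` a ` X = f ` X"
    and g': "g \<in> transformations X" "inj_on a (g ` X)"
    using f g by (auto simp: iff)
  have aX: "a ` X \<subseteq> X" using a by (auto simp: transformations_mem)
  have im: "vmult X a f g ` Y = g ` a ` f ` Y" if "Y \<subseteq> X" for Y
    using that by (force simp: vmult_apply image_image)
  have "g ` a ` f ` X \<subseteq> g ` X" using a f' by (auto simp: transformations_mem)
  then have "inj_on a (g ` a ` f ` X)" using g' by (blast intro: inj_on_subset)
  then show ?thesis using f' g' a aX by (simp add: iff im vmult_closed)
qed

lemma rank_Reg_variant_le:
  assumes X: "finite X" and a: "a \<in> transformations X" and f: "f \<in> Reg_variant X a"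
  shows "rank X f \<le> rank X a"
  using f X card_image_le[of "a ` X" f] by (simp add: Reg_variant_iff[OF X a] rank_def)

lemma rank_vmult_le:
  assumes X: "finite X" and a: "a \<in> transformations X"
    and f: "f \<in> transformations X"
  shows "rank X (vmult X a f g) \<le> rank X f" "rank X (vmult X a f g) \<le> rank X g"
proof -
  have im: "vmult X a f g ` X = (\<lambda>y. g (a y)) ` f ` X"
    by (auto simp: vmult_apply image_image)
  show "rank X (vmult X a f g) \<le> rank X f"
    unfolding rank_def im using X by (intro card_image_le) simp
  have "vmult X a f g ` X \<subseteq> g ` X"
    using a f by (auto simp: vmult_apply transformations_mem)
  then show "rank X (vmult X a f g) \<le> rank X g"
    unfolding rank_def using X by (intro card_mono) simp_all
qed

lemma idempotent_Reg_variant: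
  assumes "f \<in> idempotents_in (vmult X a) (transformations X)"
  shows "f \<in> Reg_variant X a" and "x \<in> X \<Longrightarrow> f (a (f x)) = f x"
proof -
  show "f \<in> Reg_variant X a"
    using assms unfolding idempotents_in_Reg_variant by (simp add: idempotents_in_def)
  show "f (a (f x)) = f x" if "x \<in> X"
    using assms that by (metis (mono_tags, lifting) idempotents_in_def mem_Collect_eq vmult_apply)
qed

lemma idempotents_in_vmultI:
  assumes "a \<in> transformations X" "f \<in> transformations X" "\<And>x. x \<in> X \<Longrightarrow> f (a (f x)) = f x"
  shows "f \<in> idempotents_in (vmult X a) (transformations X)"
  using assms
  by (auto simp: idempotents_in_def vmult_closed vmult_apply intro!: transformations_eqI[of f X])

text \<open>
  A product of idempotents is regular, and if its rank is maximal then it is a right inverse of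
  \<open>a\<close> on \<open>im a\<close>.
\<close>

lemma generated_by_idempotents:
  assumes X: "finite X" and a: "a \<in> transformations X"
    and f: "f \<in> generated_subsemigroup (vmult X a) (idempotents_in (vmult X a) (transformations X))"
  shows "f \<in> Reg_variant X a \<and> (rank X f = rank X a \<longrightarrow> (\<forall>z\<in>a ` X. a (f z) = z))"
  using f
proof induction
  case (incl f)
  note reg = idempotent_Reg_variant(1)[OF incl] and idem = idempotent_Reg_variant(2)[OF incl]
  have "a (f z) = z" if rank: "rank X f = rank X a" and z: "z \<in> a ` X" for z
  proof -
    have fT: "f \<in> transformations X" and im: "f ` a ` X = f ` X" and inj: "inj_on a (f ` X)"
      using reg by (auto simp: Reg_variant_iff[OF X a])
    \<comment> \<open>Equality of ranks makes \<open>f\<close> injective on \<open>im a\<close>, so that it can be cancelled from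
        \<open>f (a (f z)) = f z\<close>.\<close>
    have "inj_on f (a ` X)"
      using rank im X by (simp add: rank_def eq_card_imp_inj_on)
    moreover have "z \<in> X" using z a by (auto simp: transformations_mem)
    ultimately show ?thesis
      using idem[of z] z fT by (auto simp: transformations_mem dest: inj_onD)
  qed
  with reg show ?case by blast
next
  case (mult f g)
  have reg: "vmult X a f g \<in> Reg_variant X a"
    using mult.IH Reg_variant_vmult_closed[OF X a] by blast
  have fT: "f \<in> transformations X" using mult.IH by (simp add: Reg_variant_iff[OF X a])
  have "a (vmult X a f g z) = z"
    if rank: "rank X (vmult X a f g) = rank X a" and z: "z \<in> a ` X" for z
  proof -
    have "rank X f = rank X a" "rank X g = rank X a"
      using rank rank_vmult_le[OF X a fT, of g] rank_Reg_variant_le[OF X a] mult.IH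
      by (metis le_antisym)+
    moreover have "z \<in> X" using z a by (auto simp: transformations_mem)
    moreover from calculation have "a (f z) = z" "a (g z) = z" using mult.IH z by blast+
    ultimately show ?thesis by (simp add: vmult_apply)
  qed
  with reg show ?case by blast
qed

section \<open>Regular elements of non-maximal rank\<close>

text \<open>
  For idempotent \<open>a\<close>, the map \<open>t \<mapsto> t \<circ> a\<close> embeds the full transformation semigroup of \<open>im a\<close>
  into the variant; it preserves products and idempotents.
\<close>

lemma generated_embedding:
  assumes a: "a \<in> transformations X" and aa: "\<And>z. z \<in> a ` X \<Longrightarrow> a z = z"
    and t: "t \<in> generated_subsemigroup (tcomp (a ` X))
              (idempotents_in (tcomp (a ` X)) (transformations (a ` X)))"
  shows "t \<in> transformations (a ` X) \<and> (\<lambda>x\<in>X. t (a x)) \<in>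
    generated_subsemigroup (vmult X a) (idempotents_in (vmult X a) (transformations X))"
  using t
proof induction
  have aX: "z \<in> X" if "z \<in> a ` X" for z using a that by (auto simp: transformations_mem)
  {
    case (incl t)
    then have tT: "t \<in> transformations (a ` X)" and tt: "t = tcomp (a ` X) t t"
      by (auto simp: idempotents_in_def)
    have tA: "t (a x) \<in> a ` X" if "x \<in> X" for x
      using tT that by (simp add: transformations_mem)
    have tt': "t (t (a x)) = t (a x)" if "x \<in> X" for x
      using tt that by (metis imageI tcomp_apply)
    have "(\<lambda>x\<in>X. t (a x)) \<in> idempotents_in (vmult X a) (transformations X)"
    proof (rule idempotents_in_vmultI[OF a])
      show "(\<lambda>x\<in>X. t (a x)) \<in> transformations X"
        using tA aX by (auto simp: transformations_def)
      show "(\<lambda>x\<in>X. t (a x)) (a ((\<lambda>x\<in>X. t (a x)) x)) = (\<lambda>x\<in>X. t (a x)) x" if "x \<in> X" for x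
        using aX[OF tA[OF that]] aa[OF tA[OF that]] tt'[OF that] that by simp
    qed
    with tT show ?case by (blast intro: generated_subsemigroup.incl)
  next
    case (mult t u)
    have tA: "t (a x) \<in> a ` X" if "x \<in> X" for x
      using mult.IH(1) that by (simp add: transformations_mem)
    have "(\<lambda>x\<in>X. tcomp (a ` X) t u (a x)) = vmult X a (\<lambda>x\<in>X. t (a x)) (\<lambda>x\<in>X. u (a x))"
    proof
      fix x
      show "(\<lambda>x\<in>X. tcomp (a ` X) t u (a x)) x = vmult X a (\<lambda>x\<in>X. t (a x)) (\<lambda>x\<in>X. u (a x)) x"
      proof (cases "x \<in> X")
        case True
        then show ?thesis
          using aX[OF tA] aa[OF tA] by (simp add: vmult_apply tcomp_apply)
      qed (simp add: vmult_def tcomp_def compose_def)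
    qed
    then show ?case
      using mult.IH tcomp_closed[of t "a ` X" u]
      by (metis (no_types, lifting) generated_subsemigroup.mult)
  }
qed

lemma Reg_variant_factorisation:
  assumes X: "finite X" and a: "a \<in> transformations X" and aa: "\<And>z. z \<in> a ` X \<Longrightarrow> a z = z"
    and f: "f \<in> Reg_variant X a"
  obtains e h where "e \<in> idempotents_in (vmult X a) (transformations X)"
    "h \<in> idempotents_in (vmult X a) (transformations X)"
    "f = vmult X a (vmult X a e (\<lambda>x\<in>X. a (f (a x)))) h"
proof -
  have fT: "f \<in> transformations X" and im: "f ` a ` X = f ` X" and inj: "inj_on a (f ` X)"
    using f by (auto simp: Reg_variant_iff[OF X a])
  have aX: "z \<in> X" if "z \<in> a ` X" for z using a that by (auto simp: transformations_mem)
  have fX: "f x \<in> X" if "x \<in> X" for x using fT that by (simp add: transformations_mem)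
  define e where "e = (\<lambda>x\<in>X. if x \<in> a ` X then x else inv_into (a ` X) f (f x))"
  define s where "s z = (if z \<in> a ` f ` X then inv_into (f ` X) a z else z)" for z
  define h where "h = (\<lambda>x\<in>X. s (a x))"
  have eA: "e x \<in> a ` X" and fe: "f (e x) = f x" if "x \<in> X" for x
  proof -
    have "f x \<in> f ` a ` X" using im that by blast
    then show "e x \<in> a ` X" "f (e x) = f x"
      using that by (auto simp: e_def inv_into_into f_inv_into_f)
  qed
  have sX: "s z \<in> X" and as: "a (s z) = z" if z: "z \<in> a ` X" for z
  proof -
    have "s z \<in> X \<and> a (s z) = z"
    proof (cases "z \<in> a ` f ` X")
      case True
      then have "inv_into (f ` X) a z \<in> f ` X" "a (inv_into (f ` X) a z) = z"
        by (rule inv_into_into, rule f_inv_into_f)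
      then show ?thesis using True fX by (auto simp: s_def)
    next
      case False
      then show ?thesis using aX[OF z] aa[OF z] by (simp add: s_def)
    qed
    then show "s z \<in> X" "a (s z) = z" by simp_all
  qed
  have saf: "s (a (f x)) = f x" if "x \<in> X" for x
    using inj that by (simp add: s_def)
  have eT: "e \<in> transformations X"
    using eA aX by (auto simp: transformations_def e_def)
  have hT: "h \<in> transformations X"
    using sX by (auto simp: transformations_def h_def)
  have eA_fix: "e z = z" if "z \<in> a ` X" for z
    using that aX by (simp add: e_def)
  have "e \<in> idempotents_in (vmult X a) (transformations X)"
  proof (rule idempotents_in_vmultI[OF a eT])
    show "e (a (e x)) = e x" if "x \<in> X" for x
      using aa[OF eA[OF that]] eA_fix[OF eA[OF that]] by simp
  qed
  moreover have "h \<in> idempotents_in (vmult X a) (transformations X)"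
  proof (rule idempotents_in_vmultI[OF a hT])
    fix x assume x: "x \<in> X"
    then have ax: "a x \<in> a ` X" by simp
    show "h (a (h x)) = h x"
      using x as[OF ax] aX[OF ax] aa[OF ax] by (simp add: h_def)
  qed
  moreover have "f = vmult X a (vmult X a e (\<lambda>x\<in>X. a (f (a x)))) h" (is "f = ?g")
  proof (rule transformations_eqI[OF fT])
    have "(\<lambda>x\<in>X. a (f (a x))) \<in> transformations X"
      using a fX aX by (auto simp: transformations_def)
    then show "?g \<in> transformations X" by (intro vmult_closed a eT hT)
    fix x assume x: "x \<in> X"
    have ex: "a (e x) = e x" "e x \<in> X" using aa[OF eA[OF x]] aX[OF eA[OF x]] .
    have afx: "a (f x) \<in> X" "a (a (f x)) = a (f x)"
      using aX[of "a (f x)"] aa[of "a (f x)"] fX[OF x] by simp_all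
    show "f x = ?g x"
      using x ex afx fe[OF x] saf[OF x] by (simp add: vmult_apply h_def)
  qed
  ultimately show ?thesis using that by blast
qed

lemma Reg_variant_generated:
  assumes X: "finite X" and a: "a \<in> transformations X" and aa: "\<And>z. z \<in> a ` X \<Longrightarrow> a z = z"
    and f: "f \<in> Reg_variant X a" and rank: "rank X f < rank X a"
  shows "f \<in> generated_subsemigroup (vmult X a) (idempotents_in (vmult X a) (transformations X))"
    (is "_ \<in> ?S")
proof -
  have fT: "f \<in> transformations X" using f by (simp add: Reg_variant_iff[OF X a])
  define t where "t = (\<lambda>z\<in>a ` X. a (f z))"
  have tT: "t \<in> transformations (a ` X)"
    using fT a by (auto simp: t_def transformations_def)
  have "t ` a ` X \<subseteq> a ` f ` X" using a by (auto simp: t_def transformations_mem)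
  then have "card (t ` a ` X) \<le> card (f ` X)"
    using X by (meson finite_imageI surj_card_le)
  then have "rank (a ` X) t < card (a ` X)" using rank by (simp add: rank_def)
  with tT X have "t \<in> generated_subsemigroup (tcomp (a ` X))
      (idempotents_in (tcomp (a ` X)) (transformations (a ` X)))"
    by (simp add: singular_idempotent_generated)
  then have "(\<lambda>x\<in>X. t (a x)) \<in> ?S" using generated_embedding[OF a aa] by blast
  moreover have "(\<lambda>x\<in>X. t (a x)) = (\<lambda>x\<in>X. a (f (a x)))" by (auto simp: t_def)
  ultimately have m: "(\<lambda>x\<in>X. a (f (a x))) \<in> ?S" by simp
  obtain e h where "e \<in> idempotents_in (vmult X a) (transformations X)"
    "h \<in> idempotents_in (vmult X a) (transformations X)"
    and feq: "f = vmult X a (vmult X a e (\<lambda>x\<in>X. a (f (a x)))) h"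
    using Reg_variant_factorisation[OF X a aa f] .
  then have "e \<in> ?S" "h \<in> ?S" by (simp_all add: generated_subsemigroup.incl)
  then have "vmult X a (vmult X a e (\<lambda>x\<in>X. a (f (a x)))) h \<in> ?S"
    using m by (intro generated_subsemigroup.mult)
  then show ?thesis using feq by simp
qed

section \<open>The idempotent-generated subsemigroup of the variant\<close>

theorem theorem6p4:
  fixes X :: "'a set" and a :: "'a \<Rightarrow> 'a" and n r :: nat and P D E :: "('a \<Rightarrow> 'a) set"
  assumes "finite X"
    and "card X = n"
    and "a \<in> transformations X"
    and "tcomp X a a = a"
    and "r = rank X a"
    and "1 < r"
    and "r < n"
    and "P = Reg_variant X a"
    and "D = {f \<in> P. rank X f = r}"
    and "E = idempotents_in (vmult X a) (transformations X)"
  shows "idem_generated_variant X a = generated_subsemigroup (vmult X a) E \<and>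
    generated_subsemigroup (vmult X a) E = idempotents_in (vmult X a) D \<union> (P - D)"
proof (intro conjI subset_antisym subsetI)
  note X = assms(1) and a = assms(3)
  have aa: "a z = z" if "z \<in> a ` X" for z
    using assms(4) that by (metis (no_types, lifting) imageE tcomp_apply)
  {
    fix f assume "f \<in> generated_subsemigroup (vmult X a) E"
    then have fP: "f \<in> P" and top: "rank X f = r \<Longrightarrow> \<forall>z\<in>a ` X. a (f z) = z"
      using generated_by_idempotents[OF X a] assms by auto
    then have fT: "f \<in> transformations X" and im: "f ` a ` X = f ` X"
      using assms by (auto simp: Reg_variant_iff[OF X a])
    have "f \<in> idempotents_in (vmult X a) (transformations X)" if fD: "f \<in> D"
    proof (rule idempotents_in_vmultI[OF a fT])
      fix x assume "x \<in> X"
      \<comment> \<open>By regularity it suffices to consider arguments in \<open>im a\<close>.\<close>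
      then obtain z where z: "z \<in> a ` X" "f x = f z" using im by blast
      moreover have "rank X f = r" using fD assms by simp
      ultimately have "a (f z) = z" using top by blast
      then show "f (a (f x)) = f x" using z by simp
    qed
    then show "f \<in> idempotents_in (vmult X a) D \<union> (P - D)"
      using fP by (auto simp: idempotents_in_def)
  next
    fix f assume "f \<in> idempotents_in (vmult X a) D \<union> (P - D)"
    then show "f \<in> generated_subsemigroup (vmult X a) E"
    proof
      assume "f \<in> idempotents_in (vmult X a) D"
      then have "f \<in> E" using assms by (simp add: idempotents_in_def Reg_variant_iff[OF X a])
      then show ?thesis by (rule generated_subsemigroup.incl)
    next
      assume f: "f \<in> P - D"
      then have "rank X f < rank X a"
        using rank_Reg_variant_le[OF X a, of f] assms by auto
      then show ?thesis using Reg_variant_generated[OF X a aa, of f] f assms by simp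
    qed
  }
qed (use assms in \<open>simp_all add: idem_generated_variant_def\<close>)

end
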